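(* Consider a decision maker that, at time $k=1,2,\dots,K$, chooses a consumption bundle $\beta_k\in\mathbb{R}_+^m$ subject to a utility constraint $u_k(\beta)\ge u_k^\ast$, where $u_k:\mathbb{R}_+^m\to\mathbb{R}$ and $u_k^\ast\in\mathbb{R}$. Suppose the utility constraint is active at the chosen bundle, i.e. $u_k(\beta_k)=u_k^\ast$ for all $k$, that an analyst knows the dataset $\mathcal{D}_{RP}=\{u_k,u_k^\ast,\beta_k\}_{k=1}^K$, and that the set $\{\beta: u_k(\beta)\ge u_k^\ast\}$ of feasible bundles is compact for all $k$. Then the following statements are equivalent: 1) There exists a monotone, continuous cost $g:\mathbb{R}_+^m\to\mathbb{R}_+$ that rationalizes the dataset $\mathcal{D}_{RP}$, that is, $$\beta_k\in\operatorname*{argmin}_{\beta\in\mathbb{R}_+^m}\ g(\beta)\quad\text{subject to } u_k(\beta)\ge u_k^\ast,\qquad \forall k=1,2,\dots,K.$$ 2) The dataset $\{\beta_k,\ u_k(\beta_k)-u_k(\cdot)\}_{k=1}^K$ satisfies GARP: $$\beta_k\ge_H\beta_j\ \Longrightarrow\ u_j(\beta_j)\ge u_j(\beta_k),\qquad\forall k\ne j,$$ where the relation $\beta_k\ge_H\beta_j$ means that there exist indices $i_1,i_2,\dots,i_L$ such that $u_k(\beta_{i_1})\ge u_k(\beta_k)$, $u_{i_1}(\beta_{i_2})\ge u_{i_1}(\beta_{i_1})$, $\dots$, $u_{i_L}(\beta_j)\ge u_{i_L}(\beta_{i_L})$. 3) There exist positive scalars $g_k,\lambda_k>0$, $k=1,2,\dots,K$,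 such that $$g_j-g_k-\lambda_k\big(u_k(\beta_j)-u_k(\beta_k)\big)\ge 0\qquad\forall k,j\in\{1,2,\dots,K\},\ k\ne j,$$ or equivalently, $\lambda_k u_k(\beta_k)-g_k\ge\lambda_k u_k(\beta_j)-g_j$ for all $k\neq j$. The reconstructed cost $$\hat g(\beta)=\max_{k\in\{1,2,\dots,K\}}\big\{g_k+\lambda_k\big(u_k(\beta)-u_k(\beta_k)\big)\big\},$$ defined in terms of the feasible variables $g_k,\lambda_k$ of the inequalities in 3), is monotone, continuous and rationalizes $\{\beta_k,\ u_k(\cdot)\ge u_k^\ast\}_{k=1}^K$ in the sense of 1).
   Context: $\mathbb{R}_+^m$ is the set of vectors in $\mathbb{R}^m$ with nonnegative entries; monotonicity is understood with respect to the element-wise partial order. The analyst's aim is to test whether the decision maker chooses its bundles by minimizing an unknown cost $g$ subject to the known lower bounds on utility, i.e. to identify whether there exists a cost $g$ that rationalizes the known dataset $\mathcal{D}_{RP}$. GARP is the Generalized Axiom of Revealed Preference: for a dataset $\{\beta_k,g_k(\cdot)\}_{k=1}^K$ of bundles and constraint functions it says that $\beta_k\ge_H\beta_j$ implies $g_j(\beta_k)\ge0$, where $\beta_k\ge_H\beta_j$ means $g_k(\beta_{i_1})\le 0$, $g_{i_1}(\beta_{i_2})\le0$, $\dots$, $g_{i_L}(\beta_j)\le0$ for some indices $i_1,\dots,i_L$; here it is applied with constraint functions $u_k(\beta_k)-u_k(\cdot)$.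
   Formalization: Monotone is read as strictly monotone (increasing or decreasing), since a constant cost rationalizes any data; each u_k is assumed continuous and strictly monotone, as otherwise the reconstructed cost need not be; the reconstructed cost is not claimed to be nonnegative. *)

theory Defs
  imports "HOL-Analysis.Analysis"
begin

definition nonneg_orthant :: "(real ^ 'm) set" where
  "nonneg_orthant = {x. \<forall>i. 0 \<le> x $ i}"

text \<open>
  The order on \<^typ>\<open>real ^ 'm\<close> is the element-wise partial order, so \<open>x < y\<close> means
  that \<open>x $ i \<le> y $ i\<close> for all \<open>i\<close>, with strict inequality for at least one \<open>i\<close>.
  Monotonicity has to be strict: a constant cost rationalizes every dataset. Both directions
  are admitted: a function that is increasing on the orthant has no nonempty compact upper
  level set, so for increasing utilities the compactness hypothesis could never be met.
\<close>

definition elementwise_monotone :: "(real ^ 'm \<Rightarrow> real) \<Rightarrow> bool" where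
  "elementwise_monotone f \<longleftrightarrow>
     strict_mono_on nonneg_orthant f \<or> strict_antimono_on nonneg_orthant f"

definition feasible :: "(real ^ 'm \<Rightarrow> real) \<Rightarrow> real \<Rightarrow> (real ^ 'm) set" where
  "feasible v c = {x \<in> nonneg_orthant. v x \<ge> c}"

definition rationalizes ::
  "nat \<Rightarrow> (nat \<Rightarrow> real ^ 'm \<Rightarrow> real) \<Rightarrow> (nat \<Rightarrow> real) \<Rightarrow> (nat \<Rightarrow> real ^ 'm) \<Rightarrow>
     (real ^ 'm \<Rightarrow> real) \<Rightarrow> bool" where
  "rationalizes K u ustar \<beta> g \<longleftrightarrow>
     (\<forall>k\<in>{1..K}. is_arg_min g (\<lambda>x. x \<in> feasible (u k) (ustar k)) (\<beta> k))"

text \<open>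
  The relation and GARP for a dataset of bundles \<open>\<beta> k\<close> and constraint functions \<open>c k\<close>
  (constraints \<open>c k x \<le> 0\<close>). The indices are \<open>i 1, \<dots>, i L\<close>. Since \<open>i 1 = k\<close> is allowed
  and \<open>c k (\<beta> k) = 0\<close> in the intended use, \<open>L \<ge> 1\<close> also covers the direct
  relation \<open>c k (\<beta> j) \<le> 0\<close>.
\<close>

definition revealed_H ::
  "nat \<Rightarrow> (nat \<Rightarrow> real ^ 'm) \<Rightarrow> (nat \<Rightarrow> real ^ 'm \<Rightarrow> real) \<Rightarrow> nat \<Rightarrow> nat \<Rightarrow> bool" where
  "revealed_H K \<beta> c k j \<longleftrightarrow>
     (\<exists>(L::nat) (i::nat \<Rightarrow> nat). 1 \<le> L \<and> (\<forall>l\<in>{1..L}. i l \<in> {1..K}) \<and>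
        c k (\<beta> (i 1)) \<le> 0 \<and>
        (\<forall>l\<in>{1..<L}. c (i l) (\<beta> (i (l + 1))) \<le> 0) \<and>
        c (i L) (\<beta> j) \<le> 0)"

definition GARP ::
  "nat \<Rightarrow> (nat \<Rightarrow> real ^ 'm) \<Rightarrow> (nat \<Rightarrow> real ^ 'm \<Rightarrow> real) \<Rightarrow> bool" where
  "GARP K \<beta> c \<longleftrightarrow>
     (\<forall>k\<in>{1..K}. \<forall>j\<in>{1..K}. k \<noteq> j \<longrightarrow> revealed_H K \<beta> c k j \<longrightarrow> c j (\<beta> k) \<ge> 0)"

definition cost_inequalities ::
  "nat \<Rightarrow> (nat \<Rightarrow> real ^ 'm \<Rightarrow> real) \<Rightarrow> (nat \<Rightarrow> real ^ 'm) \<Rightarrow>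
     (nat \<Rightarrow> real) \<Rightarrow> (nat \<Rightarrow> real) \<Rightarrow> bool" where
  "cost_inequalities K u \<beta> \<gamma> \<mu> \<longleftrightarrow>
     (\<forall>k\<in>{1..K}. \<gamma> k > 0 \<and> \<mu> k > 0) \<and>
     (\<forall>k\<in>{1..K}. \<forall>j\<in>{1..K}. k \<noteq> j \<longrightarrow>
        \<gamma> j - \<gamma> k - \<mu> k * (u k (\<beta> j) - u k (\<beta> k)) \<ge> 0)"

definition cost_inequalities_alt ::
  "nat \<Rightarrow> (nat \<Rightarrow> real ^ 'm \<Rightarrow> real) \<Rightarrow> (nat \<Rightarrow> real ^ 'm) \<Rightarrow>
     (nat \<Rightarrow> real) \<Rightarrow> (nat \<Rightarrow> real) \<Rightarrow> bool" where
  "cost_inequalities_alt K u \<beta> \<gamma> \<mu> \<longleftrightarrow>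
     (\<forall>k\<in>{1..K}. \<gamma> k > 0 \<and> \<mu> k > 0) \<and>
     (\<forall>k\<in>{1..K}. \<forall>j\<in>{1..K}. k \<noteq> j \<longrightarrow>
        \<mu> k * u k (\<beta> k) - \<gamma> k \<ge> \<mu> k * u k (\<beta> j) - \<gamma> j)"

definition reconstructed_cost ::
  "nat \<Rightarrow> (nat \<Rightarrow> real ^ 'm \<Rightarrow> real) \<Rightarrow> (nat \<Rightarrow> real ^ 'm) \<Rightarrow>
     (nat \<Rightarrow> real) \<Rightarrow> (nat \<Rightarrow> real) \<Rightarrow> real ^ 'm \<Rightarrow> real" where
  "reconstructed_cost K u \<beta> \<gamma> \<mu> x =
     Max ((\<lambda>k. \<gamma> k + \<mu> k * (u k x - u k (\<beta> k))) ` {1..K})"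

end

theory Submission
  imports Defs
begin

text \<open>
  Compactness of the feasible sets forces every utility to be strictly decreasing. Hence a
  decreasing cost can be lowered by enlarging a bundle that is strictly feasible, which gives
  GARP, while an increasing cost only rationalizes data with all bundles equal to 0.
  Conversely, GARP turns the closure \<open>R\<close> of the revealed relation into a preorder along which
  numbers for the inequalities can be written down explicitly: with \<open>r j\<close> the number of
  \<open>R\<close>-predecessors of \<open>j\<close>, take \<open>B ^ r j\<close> and \<open>B ^ r j / \<delta>\<close>, where every negative
  utility gap \<open>u k (\<beta> j) - u k (\<beta> k)\<close> is at most \<open>- \<delta>\<close> and \<open>B\<close> is large. The reconstructed cost may take negative values;
  its exponential is the nonnegative cost required in 1).
\<close>

section \<open>Positive solutions of the inequalities\<close>

text \<open>Here \<open>a k j\<close> stands for the gap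
  \<open>u k (\<beta> j) - u k (\<beta> k)\<close> and \<open>cyc\<close> for GARP along the
  transitive closure, so that only a finite combinatorial problem remains.\<close>

lemma Afriat_numbers:
  fixes a :: "'i \<Rightarrow> 'i \<Rightarrow> real"
  assumes fin: "finite I"
    and cyc: "\<And>k j. (k, j) \<in> {(k, j). k \<in> I \<and> j \<in> I \<and> 0 \<le> a k j}\<^sup>+ \<Longrightarrow> a j k \<le> 0"
  obtains \<gamma> \<mu> where "\<And>k. 0 < \<gamma> k" "\<And>k. 0 < \<mu> k"
    "\<And>k j. k \<in> I \<Longrightarrow> j \<in> I \<Longrightarrow> k \<noteq> j \<Longrightarrow> \<mu> k * a k j \<le> \<gamma> j - \<gamma> k"
proof -
  \<comment> \<open>Reflexivity makes each \<open>j\<close> in \<open>I\<close> its own predecessor;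
    this is the element that makes the inclusion behind \<open>r_less\<close> proper.\<close>
  define R where "R = {(k, j). k \<in> I \<and> j \<in> I \<and> 0 \<le> a k j}\<^sup>*"
  define r where "r j = card {k \<in> I. (k, j) \<in> R}" for j
  define V where "V = (\<lambda>(k, j). a k j) ` (I \<times> I)"
  have finV: "finite V"
    using fin by (simp add: V_def)
  \<comment> \<open>The inserted 0 and 1 keep both extrema defined when there are no gaps of the
    required kind, and give \<open>0 \<le> M\<close> and \<open>0 < \<delta>\<close>.\<close>
  define M where "M = Max (insert 0 V)"
  define \<delta> where "\<delta> = Min (insert 1 (uminus ` {v \<in> V. v < 0}))"
  have M0: "0 \<le> M" and M: "k \<in> I \<Longrightarrow> j \<in> I \<Longrightarrow> a k j \<le> M" for k j
    unfolding M_def using finV by (intro Max_ge; force simp: V_def)+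
  have \<delta>0: "0 < \<delta>"
    using finV by (simp add: \<delta>_def)
  have \<delta>: "a k j \<le> - \<delta>" if "k \<in> I" "j \<in> I" "a k j < 0" for k j
  proof -
    have "- a k j \<in> uminus ` {v \<in> V. v < 0}"
      using that by (auto simp: V_def)
    hence "\<delta> \<le> - a k j"
      unfolding \<delta>_def using finV by (intro Min_le) auto
    thus ?thesis by simp
  qed
  \<comment> \<open>Chosen so that one more factor \<open>B\<close> pays for the largest gap:
    \<open>B ^ Suc n - B ^ n = B ^ n / \<delta> * M\<close>.\<close>
  define B where "B = 1 + M / \<delta>"
  have B1: "1 \<le> B"
    using M0 \<delta>0 by (simp add: B_def)
  define \<gamma> where "\<gamma> j = B ^ r j" for j
  define \<mu> where "\<mu> j = \<gamma> j / \<delta>" for j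
  have \<gamma>0: "0 < \<gamma> j" for j
    using B1 by (simp add: \<gamma>_def)
  have \<mu>0: "0 < \<mu> j" for j
    using \<gamma>0 \<delta>0 by (simp add: \<mu>_def)
  have r_less: "r k < r j" if "k \<in> I" "j \<in> I" "(k, j) \<in> R" "(j, k) \<notin> R" for k j
  proof -
    have "{i \<in> I. (i, k) \<in> R} \<subset> {i \<in> I. (i, j) \<in> R}"
      using that unfolding R_def by (auto intro: rtrancl_trans)
    thus ?thesis
      unfolding r_def using fin by (intro psubset_card_mono) auto
  qed
  have r_eq: "r k = r j" if "(k, j) \<in> R" "(j, k) \<in> R" for k j
  proof -
    have "{i \<in> I. (i, k) \<in> R} = {i \<in> I. (i, j) \<in> R}"
      using that unfolding R_def by (auto intro: rtrancl_trans)
    thus ?thesis by (simp add: r_def)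
  qed
  have "\<mu> k * a k j \<le> \<gamma> j - \<gamma> k" if I: "k \<in> I" "j \<in> I" "k \<noteq> j" for k j
  proof -
    consider "r k < r j" | "r j \<le> r k" "(k, j) \<in> R" | "r j \<le> r k" "a k j < 0"
    proof (cases "r k < r j \<or> a k j < 0")
      case False
      with I have "(k, j) \<in> R"
        by (auto simp: R_def)
      with False show thesis
        using that(2) by simp
    qed (use that in linarith)
    thus ?thesis
    proof cases
      case 1
      have "\<mu> k * a k j \<le> \<mu> k * M"
        using M I \<mu>0[of k] by (intro mult_left_mono) auto
      also have "\<dots> = B ^ Suc (r k) - \<gamma> k"
        using \<delta>0 by (simp add: \<mu>_def \<gamma>_def B_def field_simps)
      also have "\<dots> \<le> \<gamma> j - \<gamma> k"
        unfolding \<gamma>_def using 1 B1 by (intro diff_right_mono power_increasing) auto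
      finally show ?thesis .
    next
      case 2
      \<comment> \<open>Without an increase of rank, \<open>k\<close> and \<open>j\<close> lie in
        one class of \<open>R\<close>. As they differ, the way back from \<open>j\<close> to
        \<open>k\<close> is a proper chain, to which \<open>cyc\<close> applies.\<close>
      hence "(j, k) \<in> R"
        using r_less[of k j] I by auto
      hence "r k = r j" "a k j \<le> 0"
        using 2 r_eq[of k j] cyc[of j k] I(3) by (auto simp: R_def rtrancl_eq_or_trancl)
      thus ?thesis
        using \<mu>0[of k] by (simp add: \<gamma>_def mult_nonneg_nonpos)
    next
      case 3
      \<comment> \<open>The divisor \<open>\<delta>\<close> in \<open>\<mu> k\<close> makes a
        negative gap cancel all of \<open>\<gamma> k\<close>, whatever the size of
        \<open>\<gamma> j\<close>.\<close>
      have "\<mu> k * a k j \<le> \<mu> k * (- \<delta>)"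
        using \<delta> I 3 \<mu>0[of k] by (intro mult_left_mono) auto
      also have "\<dots> = - \<gamma> k"
        using \<delta>0 by (simp add: \<mu>_def)
      also have "\<dots> \<le> \<gamma> j - \<gamma> k"
        using \<gamma>0[of j] by simp
      finally show ?thesis .
    qed
  qed
  with \<gamma>0 \<mu>0 show thesis
    by (rule that)
qed

section \<open>Finite maxima, the orthant and compact feasible sets\<close>

lemma continuous_on_Max_image:
  fixes f :: "'i \<Rightarrow> 'a::topological_space \<Rightarrow> real"
  assumes "finite I" "I \<noteq> {}" "\<And>i. i \<in> I \<Longrightarrow> continuous_on S (f i)"
  shows "continuous_on S (\<lambda>x. Max ((\<lambda>i. f i x) ` I))"
  using assms
  by (induction I rule: finite_ne_induct) (auto intro!: continuous_on_max)

text \<open>The vector \<open>1\<close> has all entries 1. Large shifts along it leave every bounded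
  set; small ones enlarge a bundle without losing a strict utility inequality.\<close>

lemma orthant_shift:
  fixes x :: "real ^ 'm"
  assumes "x \<in> nonneg_orthant" "0 < t"
  shows "x + t *\<^sub>R 1 \<in> nonneg_orthant" "x < x + t *\<^sub>R 1"
  using assms by (auto simp: nonneg_orthant_def less_le_not_le less_eq_vec_def
      add_nonneg_nonneg)

lemma orthant_shift_tendsto:
  fixes x :: "real ^ 'm"
  shows "(\<lambda>n. x + inverse (real (Suc n)) *\<^sub>R 1) \<longlonglongrightarrow> x"
  using tendsto_add[OF tendsto_const tendsto_scaleR[OF LIMSEQ_inverse_real_of_nat tendsto_const],
      of x "1 :: real ^ 'm"]
  by simp

lemma zero_less_orthant:
  fixes x :: "real ^ 'm"
  assumes "x \<in> nonneg_orthant" "x \<noteq> 0"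
  shows "0 < x"
  using assms by (auto simp: nonneg_orthant_def less_le_not_le less_eq_vec_def vec_eq_iff)
    (metis order.antisym)

text \<open>If \<open>v\<close> were increasing, every shift of \<open>b\<close> along the diagonal
  would remain feasible, and the feasible set would be unbounded.\<close>

lemma strict_antimono_on_compact_feasible:
  fixes v :: "real ^ 'm \<Rightarrow> real"
  assumes "elementwise_monotone v" "b \<in> nonneg_orthant" "c \<le> v b"
    and "compact (feasible v c)"
  shows "strict_antimono_on nonneg_orthant v"
proof (rule ccontr)
  assume "\<not> strict_antimono_on nonneg_orthant v"
  with assms(1) have mono: "strict_mono_on nonneg_orthant v"
    by (simp add: elementwise_monotone_def)
  obtain C where C: "\<And>x. x \<in> feasible v c \<Longrightarrow> norm x \<le> C"
    using compact_imp_bounded[OF assms(4)] by (auto simp: bounded_iff)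
  define t where "t = \<bar>C\<bar> + 1"
  have t: "0 < t" by (simp add: t_def)
  have "v b < v (b + t *\<^sub>R 1)"
    using mono orthant_shift[OF assms(2) t] assms(2) by (auto simp: monotone_on_def)
  hence "b + t *\<^sub>R 1 \<in> feasible v c"
    using orthant_shift[OF assms(2) t] assms(3) by (simp add: feasible_def)
  hence "norm (b + t *\<^sub>R 1) \<le> C" by (rule C)
  moreover have "t \<le> norm (b + t *\<^sub>R 1)"
  proof -
    \<comment> \<open>Any single coordinate bounds the norm from below, and index types are
      nonempty.\<close>
    fix i
    have "t \<le> (b + t *\<^sub>R 1) $ i"
      using assms(2) by (simp add: nonneg_orthant_def)
    also have "\<dots> \<le> norm (b + t *\<^sub>R 1)"
      using component_le_norm_cart[of "b + t *\<^sub>R 1" i] by linarith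
    finally show ?thesis .
  qed
  ultimately show False by (simp add: t_def)
qed

section \<open>GARP and the inequalities\<close>

lemma cost_inequalities_iff_alt:
  "cost_inequalities K u \<beta> \<gamma> \<mu> \<longleftrightarrow> cost_inequalities_alt K u \<beta> \<gamma> \<mu>"
  by (auto simp: cost_inequalities_def cost_inequalities_alt_def algebra_simps)

lemma revealed_HE:
  assumes "revealed_H K \<beta> c k j"
  obtains L :: nat and i where "1 \<le> L" "\<forall>l\<in>{1..L}. i l \<in> {1..K}" "c k (\<beta> (i 1)) \<le> 0"
    "\<forall>l\<in>{1..<L}. c (i l) (\<beta> (i (l + 1))) \<le> 0" "c (i L) (\<beta> j) \<le> 0"
  using assms unfolding revealed_H_def by (elim exE conjE) (rule that; assumption)

text \<open>A chain grows at its far end: the old endpoint becomes the last intermediate index.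
  Since \<open>revealed_H\<close> demands an intermediate index, a single link uses \<open>k\<close>
  itself, which is where \<open>diag\<close> enters.\<close>

lemma trancl_imp_revealed_H:
  assumes "(k, j) \<in> {(k, j). k \<in> {1..K} \<and> j \<in> {1..K} \<and> c k (\<beta> j) \<le> 0}\<^sup>+"
    and diag: "c k (\<beta> k) \<le> 0"
  shows "revealed_H K \<beta> c k j"
  using assms(1)
proof (induction rule: trancl_induct)
  case (base j)
  thus ?case
    unfolding revealed_H_def using diag
    by (intro exI[of _ "1::nat"] exI[of _ "\<lambda>_. k"]) auto
next
  case (step j l)
  from step.IH obtain L :: nat and i where Li: "1 \<le> L" "\<forall>l\<in>{1..L}. i l \<in> {1..K}"
    "c k (\<beta> (i 1)) \<le> 0" "\<forall>l\<in>{1..<L}. c (i l) (\<beta> (i (l + 1))) \<le> 0" "c (i L) (\<beta> j) \<le> 0"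
    by (rule revealed_HE)
  define i' where "i' = i(Suc L := j)"
  have "\<forall>l\<in>{1..Suc L}. i' l \<in> {1..K}"
    using Li(2) step by (auto simp: i'_def)
  moreover have "\<forall>l\<in>{1..<Suc L}. c (i' l) (\<beta> (i' (l + 1))) \<le> 0"
    using Li by (auto simp: i'_def less_Suc_eq)
  ultimately show ?case
    unfolding revealed_H_def using Li step
    by (intro exI[of _ "Suc L"] exI[of _ i']) (auto simp: i'_def)
qed

lemma GARP_imp_cost_inequalities:
  fixes u :: "nat \<Rightarrow> real ^ 'm \<Rightarrow> real"
  assumes "GARP K \<beta> (\<lambda>k x. u k (\<beta> k) - u k x)"
  shows "\<exists>\<gamma> \<mu>. cost_inequalities K u \<beta> \<gamma> \<mu>"
proof -
  define a where "a k j = u k (\<beta> j) - u k (\<beta> k)" for k j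
  have "a j k \<le> 0"
    if kj: "(k, j) \<in> {(k, j). k \<in> {1..K} \<and> j \<in> {1..K} \<and> 0 \<le> a k j}\<^sup>+" for k j
  \<comment> \<open>GARP compares distinct indices only; on the diagonal the gap is 0.\<close>
  proof (cases "k = j")
    case False
    have "k \<in> {1..K}" "j \<in> {1..K}"
      using kj by (auto dest: tranclD tranclD2)
    moreover have "revealed_H K \<beta> (\<lambda>k x. u k (\<beta> k) - u k x) k j"
      using kj by (intro trancl_imp_revealed_H) (simp_all add: a_def)
    ultimately show ?thesis
      using assms False by (auto simp: GARP_def a_def)
  qed (simp add: a_def)
  then obtain \<gamma> \<mu> where "\<And>k. 0 < \<gamma> k" "\<And>k. 0 < \<mu> k"
    "\<And>k j. k \<in> {1..K} \<Longrightarrow> j \<in> {1..K} \<Longrightarrow> k \<noteq> j \<Longrightarrow> \<mu> k * a k j \<le> \<gamma> j - \<gamma> k"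
    using Afriat_numbers[OF finite_atLeastAtMost, of 1 K a] by blast
  hence "cost_inequalities K u \<beta> \<gamma> \<mu>"
    by (simp add: cost_inequalities_def a_def)
  thus ?thesis by blast
qed

section \<open>From a rationalizing cost to GARP\<close>

text \<open>Each bundle of a chain is feasible for the problem solved by its predecessor, so the
  cost cannot fall along the chain. If GARP failed at its ends, a slightly enlarged
  \<open>\<beta> k\<close> would be feasible for \<open>j\<close> and cheaper than
  \<open>\<beta> j\<close>.\<close>

lemma antimono_rationalizes_imp_GARP:
  fixes u :: "nat \<Rightarrow> real ^ 'm \<Rightarrow> real"
  assumes rat: "rationalizes K u ustar \<beta> g"
    and g: "strict_antimono_on nonneg_orthant g"
    and cont: "\<And>k. k \<in> {1..K} \<Longrightarrow> continuous_on nonneg_orthant (u k)"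
    and act: "\<And>k. k \<in> {1..K} \<Longrightarrow> u k (\<beta> k) = ustar k"
  shows "GARP K \<beta> (\<lambda>k x. u k (\<beta> k) - u k x)"
  unfolding GARP_def
proof (intro ballI impI)
  fix k j
  assume k: "k \<in> {1..K}" and j: "j \<in> {1..K}"
    and rev: "revealed_H K \<beta> (\<lambda>k x. u k (\<beta> k) - u k x) k j"
  from rev obtain L :: nat and i where Li: "1 \<le> L" "\<forall>l\<in>{1..L}. i l \<in> {1..K}"
    "u k (\<beta> k) - u k (\<beta> (i 1)) \<le> 0"
    "\<forall>l\<in>{1..<L}. u (i l) (\<beta> (i l)) - u (i l) (\<beta> (i (l + 1))) \<le> 0"
    "u (i L) (\<beta> (i L)) - u (i L) (\<beta> j) \<le> 0"
    by (rule revealed_HE)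
  have orth: "\<beta> k \<in> nonneg_orthant" if "k \<in> {1..K}" for k
    using rat that by (auto simp: rationalizes_def is_arg_min_def feasible_def)
  have min: "g (\<beta> k) \<le> g x" if "k \<in> {1..K}" "x \<in> nonneg_orthant" "u k (\<beta> k) \<le> u k x" for k x
    using rat that act[of k]
    by (fastforce simp: rationalizes_def is_arg_min_def feasible_def not_less)
  have chain: "1 \<le> l \<longrightarrow> l \<le> L \<longrightarrow> g (\<beta> k) \<le> g (\<beta> (i l))" for l
  proof (induction l)
    case (Suc l)
    show ?case
    proof (cases "l = 0")
      case True
      thus ?thesis using min[OF k orth] Li(1,2,3) by auto
    next
      case False
      show ?thesis
      proof (intro impI)
        assume "Suc l \<le> L"
        with False have "g (\<beta> (i l)) \<le> g (\<beta> (i (Suc l)))"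
          using Li(2,4) by (intro min orth) auto
        with Suc False \<open>Suc l \<le> L\<close> show "g (\<beta> k) \<le> g (\<beta> (i (Suc l)))" by auto
      qed
    qed
  qed simp
  have "g (\<beta> (i L)) \<le> g (\<beta> j)"
    using Li j by (intro min orth) auto
  with chain[of L] Li(1) have gkj: "g (\<beta> k) \<le> g (\<beta> j)" by auto
  show "0 \<le> u j (\<beta> j) - u j (\<beta> k)"
  proof (rule ccontr)
    assume "\<not> 0 \<le> u j (\<beta> j) - u j (\<beta> k)"
    hence gap: "u j (\<beta> j) < u j (\<beta> k)" by simp
    \<comment> \<open>Approaching \<open>\<beta> k\<close> strictly from above lowers the cost and
      stays in the orthant, where \<open>u j\<close> is continuous.\<close>
    define x where "x n = \<beta> k + inverse (real (Suc n)) *\<^sub>R 1" for n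
    have x: "x n \<in> nonneg_orthant" "\<beta> k < x n" for n
      unfolding x_def by (intro orthant_shift orth k; simp)+
    have "x \<longlonglongrightarrow> \<beta> k"
      unfolding x_def[abs_def] by (rule orthant_shift_tendsto)
    with cont[OF j] have "(\<lambda>n. u j (x n)) \<longlonglongrightarrow> u j (\<beta> k)"
      by (rule continuous_on_tendsto_compose) (use orth[OF k] x(1) in auto)
    from order_tendstoD(1)[OF this gap] obtain n where "u j (\<beta> j) < u j (x n)"
      by (auto simp: eventually_sequentially)
    hence "g (\<beta> j) \<le> g (x n)"
      using x by (intro min j) auto
    moreover have "g (x n) < g (\<beta> k)"
      using g x orth[OF k] by (auto simp: monotone_on_def)
    ultimately show False using gkj by simp
  qed
qed

text \<open>The bundle 0 has the least cost and the greatest utility, hence is feasible in every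
  problem and the only minimizer. With all bundles equal, every gap vanishes.\<close>

lemma mono_rationalizes_imp_GARP:
  fixes u :: "nat \<Rightarrow> real ^ 'm \<Rightarrow> real"
  assumes rat: "rationalizes K u ustar \<beta> g"
    and g: "strict_mono_on nonneg_orthant g"
    and u: "\<And>k. k \<in> {1..K} \<Longrightarrow> strict_antimono_on nonneg_orthant (u k)"
  shows "GARP K \<beta> (\<lambda>k x. u k (\<beta> k) - u k x)"
proof -
  have "\<beta> k = 0" if k: "k \<in> {1..K}" for k
  proof (rule ccontr)
    assume "\<beta> k \<noteq> 0"
    moreover have \<beta>: "\<beta> k \<in> nonneg_orthant" "ustar k \<le> u k (\<beta> k)"
      and min: "\<And>x. x \<in> feasible (u k) (ustar k) \<Longrightarrow> \<not> g x < g (\<beta> k)"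
      using rat k by (auto simp: rationalizes_def is_arg_min_def feasible_def)
    ultimately have "0 < \<beta> k" by (intro zero_less_orthant)
    moreover have 0: "0 \<in> nonneg_orthant" by (simp add: nonneg_orthant_def)
    ultimately have "g 0 < g (\<beta> k)" "u k (\<beta> k) < u k 0"
      using g u[OF k] \<beta> by (auto simp: monotone_on_def)
    with min[of 0] 0 \<beta> show False by (simp add: feasible_def)
  qed
  thus ?thesis by (simp add: GARP_def)
qed

section \<open>The reconstructed cost\<close>

text \<open>Every piece decreases strictly because \<open>\<mu> k > 0\<close>, and a finite nonempty
  maximum inherits this.\<close>

lemma strict_antimono_on_reconstructed_cost:
  fixes u :: "nat \<Rightarrow> real ^ 'm \<Rightarrow> real"
  assumes "1 \<le> K" "cost_inequalities K u \<beta> \<gamma> \<mu>"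
    and u: "\<And>k. k \<in> {1..K} \<Longrightarrow> strict_antimono_on nonneg_orthant (u k)"
  shows "strict_antimono_on nonneg_orthant (reconstructed_cost K u \<beta> \<gamma> \<mu>)"
proof (rule monotone_onI)
  fix x y :: "real ^ 'm"
  assume xy: "x \<in> nonneg_orthant" "y \<in> nonneg_orthant" "x < y"
  let ?f = "\<lambda>x k. \<gamma> k + \<mu> k * (u k x - u k (\<beta> k))"
  have "?f y k < Max (?f x ` {1..K})" if k: "k \<in> {1..K}" for k
  proof -
    have "u k y < u k x"
      using u[OF k] xy by (auto simp: monotone_on_def)
    hence "?f y k < ?f x k"
      using assms(2) k by (simp add: cost_inequalities_def)
    also have "\<dots> \<le> Max (?f x ` {1..K})"
      using k by (intro Max_ge) auto
    finally show ?thesis .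
  qed
  thus "reconstructed_cost K u \<beta> \<gamma> \<mu> y < reconstructed_cost K u \<beta> \<gamma> \<mu> x"
    unfolding reconstructed_cost_def using assms(1) by (subst Max_less_iff) auto
qed

lemma continuous_on_reconstructed_cost:
  assumes "1 \<le> K" "\<And>k. k \<in> {1..K} \<Longrightarrow> continuous_on S (u k)"
  shows "continuous_on S (reconstructed_cost K u \<beta> \<gamma> \<mu>)"
  unfolding reconstructed_cost_def[abs_def]
  using assms by (intro continuous_on_Max_image continuous_intros) auto

text \<open>The number \<open>\<gamma> k\<close> is the minimum: the inequalities bound all pieces
  at \<open>\<beta> k\<close> by it, while on the feasible set of \<open>k\<close> the piece of
  index \<open>k\<close> is at least \<open>\<gamma> k\<close>.\<close>

lemma rationalizes_reconstructed_cost: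
  fixes u :: "nat \<Rightarrow> real ^ 'm \<Rightarrow> real"
  assumes "cost_inequalities K u \<beta> \<gamma> \<mu>"
    and "\<And>k. k \<in> {1..K} \<Longrightarrow> \<beta> k \<in> nonneg_orthant"
    and act: "\<And>k. k \<in> {1..K} \<Longrightarrow> u k (\<beta> k) = ustar k"
  shows "rationalizes K u ustar \<beta> (reconstructed_cost K u \<beta> \<gamma> \<mu>)"
  unfolding rationalizes_def
proof
  fix k assume k: "k \<in> {1..K}"
  have "\<gamma> j + \<mu> j * (u j (\<beta> k) - u j (\<beta> j)) \<le> \<gamma> k" if "j \<in> {1..K}" for j
    using assms(1) k that by (cases "j = k") (force simp: cost_inequalities_def)+
  hence le: "reconstructed_cost K u \<beta> \<gamma> \<mu> (\<beta> k) \<le> \<gamma> k"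
    unfolding reconstructed_cost_def using k by (subst Max_le_iff) auto
  have ge: "\<gamma> k \<le> reconstructed_cost K u \<beta> \<gamma> \<mu> x" if "x \<in> feasible (u k) (ustar k)" for x
  proof -
    have "\<gamma> k \<le> \<gamma> k + \<mu> k * (u k x - u k (\<beta> k))"
      using that assms(1) k act[OF k]
      by (auto simp: feasible_def cost_inequalities_def intro!: mult_nonneg_nonneg intro: less_imp_le)
    also have "\<dots> \<le> reconstructed_cost K u \<beta> \<gamma> \<mu> x"
      unfolding reconstructed_cost_def using k by (intro Max_ge) auto
    finally show ?thesis .
  qed
  show "is_arg_min (reconstructed_cost K u \<beta> \<gamma> \<mu>) (\<lambda>x. x \<in> feasible (u k) (ustar k)) (\<beta> k)"
    using le ge assms(2) act k by (fastforce simp: is_arg_min_def feasible_def)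
qed

section \<open>Equivalence of rationalization, GARP and the inequalities\<close>

theorem theorem2:
  fixes K :: nat
    and u :: "nat \<Rightarrow> real ^ 'm \<Rightarrow> real"
    and ustar :: "nat \<Rightarrow> real"
    and \<beta> :: "nat \<Rightarrow> real ^ 'm"
  assumes "K \<ge> 1"
    and "\<And>k. k \<in> {1..K} \<Longrightarrow> \<beta> k \<in> nonneg_orthant"
    and "\<And>k. k \<in> {1..K} \<Longrightarrow> elementwise_monotone (u k)"
    and "\<And>k. k \<in> {1..K} \<Longrightarrow> continuous_on nonneg_orthant (u k)"
    and "\<And>k. k \<in> {1..K} \<Longrightarrow> u k (\<beta> k) = ustar k"
    and "\<And>k. k \<in> {1..K} \<Longrightarrow> compact (feasible (u k) (ustar k))"
  shows
    "((\<exists>g. elementwise_monotone g \<and> continuous_on nonneg_orthant g \<and>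
           (\<forall>x\<in>nonneg_orthant. 0 \<le> g x) \<and> rationalizes K u ustar \<beta> g)
        \<longleftrightarrow> GARP K \<beta> (\<lambda>k x. u k (\<beta> k) - u k x)) \<and>
     (GARP K \<beta> (\<lambda>k x. u k (\<beta> k) - u k x)
        \<longleftrightarrow> (\<exists>\<gamma> \<mu>. cost_inequalities K u \<beta> \<gamma> \<mu>)) \<and>
     (\<forall>\<gamma> \<mu>. cost_inequalities K u \<beta> \<gamma> \<mu> \<longleftrightarrow> cost_inequalities_alt K u \<beta> \<gamma> \<mu>) \<and>
     (\<forall>\<gamma> \<mu>. cost_inequalities K u \<beta> \<gamma> \<mu> \<longrightarrow>
        elementwise_monotone (reconstructed_cost K u \<beta> \<gamma> \<mu>) \<and>
        continuous_on nonneg_orthant (reconstructed_cost K u \<beta> \<gamma> \<mu>) \<and>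
        rationalizes K u ustar \<beta> (reconstructed_cost K u \<beta> \<gamma> \<mu>))"
proof -
  \<comment> \<open>The active constraint makes \<open>\<beta> k\<close> itself the feasible point
    from which to shift.\<close>
  have anti: "strict_antimono_on nonneg_orthant (u k)" if "k \<in> {1..K}" for k
    using assms(2-6)[OF that] by (intro strict_antimono_on_compact_feasible) auto
  have recon: "strict_antimono_on nonneg_orthant (reconstructed_cost K u \<beta> \<gamma> \<mu>)"
    "continuous_on nonneg_orthant (reconstructed_cost K u \<beta> \<gamma> \<mu>)"
    "rationalizes K u ustar \<beta> (reconstructed_cost K u \<beta> \<gamma> \<mu>)"
    if "cost_inequalities K u \<beta> \<gamma> \<mu>" for \<gamma> \<mu>
    using assms that anti
    by (auto intro!: strict_antimono_on_reconstructed_cost continuous_on_reconstructed_cost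
        rationalizes_reconstructed_cost)
  have garp: "GARP K \<beta> (\<lambda>k x. u k (\<beta> k) - u k x)"
    if "elementwise_monotone g" "rationalizes K u ustar \<beta> g" for g
    using that assms(4,5) anti unfolding elementwise_monotone_def
    by (auto intro: mono_rationalizes_imp_GARP antimono_rationalizes_imp_GARP)
  \<comment> \<open>Composition with \<open>exp\<close> keeps strict monotonicity, continuity and
    minimizers.\<close>
  have cost: "\<exists>g. elementwise_monotone g \<and> continuous_on nonneg_orthant g \<and>
      (\<forall>x\<in>nonneg_orthant. 0 \<le> g x) \<and> rationalizes K u ustar \<beta> g"
    if "cost_inequalities K u \<beta> \<gamma> \<mu>" for \<gamma> \<mu>
    using recon[OF that]
    by (intro exI[of _ "\<lambda>x. exp (reconstructed_cost K u \<beta> \<gamma> \<mu> x)"])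
      (auto simp: elementwise_monotone_def monotone_on_def rationalizes_def is_arg_min_def
        intro!: continuous_intros)
  have "GARP K \<beta> (\<lambda>k x. u k (\<beta> k) - u k x)" if "cost_inequalities K u \<beta> \<gamma> \<mu>" for \<gamma> \<mu>
    using cost[OF that] garp by blast
  with garp cost show ?thesis
  proof (intro conjI allI impI iffI)
    fix \<gamma> \<mu>
    assume "cost_inequalities K u \<beta> \<gamma> \<mu>"
    from recon[OF this] show "elementwise_monotone (reconstructed_cost K u \<beta> \<gamma> \<mu>)"
      "continuous_on nonneg_orthant (reconstructed_cost K u \<beta> \<gamma> \<mu>)"
      "rationalizes K u ustar \<beta> (reconstructed_cost K u \<beta> \<gamma> \<mu>)"
      by (simp_all add: elementwise_monotone_def)
  qed (use GARP_imp_cost_inequalities[of K \<beta> u] in \<open>auto simp: cost_inequalities_iff_alt\<close>)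
qed

end
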